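(* Let $S$ be a semiring. If $S$ has very few zero-divisors (for example, if $S$ is Noetherian), then the $S$-semialgebra $S[X]$, with amount function the content function $c$, has Property (A): for every $f\in S[X]$ with $c(f)\subseteq Z(S)$ there is a nonzero $s\in S$ with $s\,c(f)=(0)$.
   Context: A semiring is a set $S$ with operations $+,\cdot$ such that $(S,+,0)$ and $(S,\cdot,1)$ are commutative monoids with $1\neq 0$, multiplication distributes over addition, and $s\cdot 0=0$ for all $s$. An ideal of $S$ is a nonempty subset closed under addition and under multiplication by elements of $S$. A proper ideal $\mathfrak p$ is prime if $ab\in\mathfrak p$ implies $a\in\mathfrak p$ or $b\in\mathfrak p$. Noetherian means every ideal is finitely generated. $Z(S)$ is the set of zero-divisors of $S$, i.e. of $z\in S$ with $zs=0$ for some nonzero $s\in S$ (so $0\in Z(S)$). $\mathrm{Ass}(S)$ is the set of prime ideals of $S$ of the form $\mathrm{Ann}(s)=\{t\in S: ts=0\}$ for some $s\in S$. $S$ has very few zero-divisors if $Z(S)$ is a finite union of prime ideals in $\mathrm{Ass}(S)$. $S[X]$ is the polynomial semiring in one indeterminate. For $f\in S[X]$, $c(f)$ is the ideal of $S$ generated by the coefficients of $f$. *)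

theory Defs
  imports "HOL-Computational_Algebra.Polynomial"
begin

text \<open>
  A semiring in the present sense (commutative, with \<open>0 \<noteq> 1\<close> and \<open>0\<close> absorbing) is a type of
  class \<^class>\<open>comm_semiring_1\<close>. The ring-based notions of ideal in the libraries do not apply
  to it, since there is no subtraction.
\<close>

definition semiring_ideal :: "'a::comm_semiring_1 set \<Rightarrow> bool" where
  "semiring_ideal I \<longleftrightarrow>
     I \<noteq> {} \<and> (\<forall>a\<in>I. \<forall>b\<in>I. a + b \<in> I) \<and> (\<forall>s. \<forall>a\<in>I. s * a \<in> I)"

definition semiring_prime_ideal :: "'a::comm_semiring_1 set \<Rightarrow> bool" where
  "semiring_prime_ideal P \<longleftrightarrow>
     semiring_ideal P \<and> P \<noteq> UNIV \<and> (\<forall>a b. a * b \<in> P \<longrightarrow> a \<in> P \<or> b \<in> P)"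

definition ideal_generated :: "'a::comm_semiring_1 set \<Rightarrow> 'a set" where
  "ideal_generated A = \<Inter>{I. semiring_ideal I \<and> A \<subseteq> I}"

definition noetherian_semiring :: "'a::comm_semiring_1 itself \<Rightarrow> bool" where
  "noetherian_semiring _ \<longleftrightarrow>
     (\<forall>I::'a set. semiring_ideal I \<longrightarrow> (\<exists>A. finite A \<and> I = ideal_generated A))"

definition zero_divisors :: "'a::comm_semiring_1 set" where
  "zero_divisors = {z. \<exists>s. s \<noteq> 0 \<and> z * s = 0}"

definition annihilator :: "'a::comm_semiring_1 \<Rightarrow> 'a set" where
  "annihilator s = {t. t * s = 0}"

definition associated_primes :: "'a::comm_semiring_1 set set" where
  "associated_primes = {P. semiring_prime_ideal P \<and> (\<exists>s. P = annihilator s)}"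

definition very_few_zero_divisors :: "'a::comm_semiring_1 itself \<Rightarrow> bool" where
  "very_few_zero_divisors _ \<longleftrightarrow>
     (\<exists>\<P>. finite \<P> \<and> \<P> \<subseteq> associated_primes \<and> (zero_divisors :: 'a set) = \<Union>\<P>)"

definition content_ideal :: "'a::comm_semiring_1 poly \<Rightarrow> 'a set" where
  "content_ideal f = ideal_generated (range (coeff f))"

text \<open>
  The argument \<open>c\<close> is the amount function, from a semialgebra \<open>'b\<close> to the ideals of \<open>'a\<close>. The
  image in the conclusion is the product \<open>s c(f)\<close>, and \<open>{0}\<close> is the zero ideal.
\<close>

definition property_A :: "('b \<Rightarrow> 'a::comm_semiring_1 set) \<Rightarrow> bool" where
  "property_A c \<longleftrightarrow>
     (\<forall>f. c f \<subseteq> zero_divisors \<longrightarrow> (\<exists>s. s \<noteq> 0 \<and> (\<lambda>t. s * t) ` c f = {0}))"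

lemma semiring_ideal_zero:
  assumes "semiring_ideal I"
  shows "0 \<in> I"
proof -
  obtain a where "a \<in> I"
    using assms by (auto simp: semiring_ideal_def)
  then have "0 * a \<in> I"
    using assms by (simp only: semiring_ideal_def)
  then show ?thesis by simp
qed

lemma semiring_ideal_ideal_generated: "semiring_ideal (ideal_generated A)"
proof -
  have "0 \<in> ideal_generated A"
    by (simp add: ideal_generated_def semiring_ideal_zero)
  moreover have "a + b \<in> ideal_generated A"
    if "a \<in> ideal_generated A" "b \<in> ideal_generated A" for a b
    using that by (simp add: ideal_generated_def semiring_ideal_def)
  moreover have "s * a \<in> ideal_generated A" if "a \<in> ideal_generated A" for s a
    using that by (simp add: ideal_generated_def semiring_ideal_def)
  ultimately show ?thesis
    unfolding semiring_ideal_def by blast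
qed

lemma semiring_ideal_content_ideal: "semiring_ideal (content_ideal f)"
  by (simp add: content_ideal_def semiring_ideal_ideal_generated)

end

theory Submission
  imports Defs
begin

text \<open>
  Prime avoidance fails for arbitrary primes of a semiring, but an annihilator is subtractive
  (if \<open>a\<close> and \<open>a + b\<close> lie in it, then so does \<open>b\<close>), and for finitely many subtractive primes the
  classical argument works: an ideal consisting of zero-divisors lies in a single \<open>Ann(s)\<close>.
  In the Noetherian case, \<open>Z(S)\<close> is the union of the maximal annihilators of nonzero elements, which
  are prime. The elements they annihilate generate an ideal that is already generated by finitely
  many of them, \<open>s\<^sub>1, \<dots>, s\<^sub>n\<close>; hence any maximal annihilator contains
  \<open>Ann(s\<^sub>1) \<inter> \<dots> \<inter> Ann(s\<^sub>n)\<close>, so by primality some \<open>Ann(s\<^sub>i)\<close>, to which it is equal.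
\<close>

section \<open>Ideals, primes and prime avoidance\<close>

lemma semiring_ideal_add: "semiring_ideal I \<Longrightarrow> a \<in> I \<Longrightarrow> b \<in> I \<Longrightarrow> a + b \<in> I"
  by (simp add: semiring_ideal_def)

lemma semiring_ideal_mult: "semiring_ideal I \<Longrightarrow> a \<in> I \<Longrightarrow> s * a \<in> I"
  by (simp add: semiring_ideal_def)

lemma semiring_ideal_prod:
  assumes "semiring_ideal I" "finite A" "x \<in> A" "f x \<in> I"
  shows "prod f A \<in> I"
  using assms semiring_ideal_mult[of I "f x" "prod f (A - {x})"]
  by (simp add: prod.remove mult.commute)

lemma semiring_prime_ideal_prod:
  assumes "semiring_prime_ideal P" "finite A" "\<And>x. x \<in> A \<Longrightarrow> f x \<notin> P"
  shows "prod f A \<notin> P"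
  using assms(2,3)
proof (induction A rule: finite_induct)
  case empty
  have "1 \<notin> P"
  proof
    assume "1 \<in> P"
    then have "s \<in> P" for s
      using assms(1) semiring_ideal_mult[of P 1 s] by (simp add: semiring_prime_ideal_def)
    then show False
      using assms(1) by (auto simp: semiring_prime_ideal_def)
  qed
  then show ?case by simp
next
  case (insert x A)
  then show ?case
    using assms(1) by (auto simp: semiring_prime_ideal_def)
qed

text \<open>If every \<open>Q\<close> had an element \<open>t Q\<close> outside \<open>P\<close>,
  the product of these would lie in each \<open>Q\<close> but, by primality, not in
  \<open>P\<close>.\<close>

lemma semiring_prime_ideal_Inter_subset:
  assumes P: "semiring_prime_ideal P" and "finite \<Q>"
    and ideal: "\<And>Q. Q \<in> \<Q> \<Longrightarrow> semiring_ideal Q" and sub: "\<Inter>\<Q> \<subseteq> P"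
  shows "\<exists>Q\<in>\<Q>. Q \<subseteq> P"
proof (rule ccontr)
  assume "\<not> ?thesis"
  then have "\<forall>Q\<in>\<Q>. \<exists>t. t \<in> Q \<and> t \<notin> P" by blast
  then obtain t where t: "\<And>Q. Q \<in> \<Q> \<Longrightarrow> t Q \<in> Q \<and> t Q \<notin> P" by metis
  have "prod t \<Q> \<in> \<Inter>\<Q>"
    using semiring_ideal_prod[OF ideal \<open>finite \<Q>\<close>] t by blast
  moreover have "prod t \<Q> \<notin> P"
    using semiring_prime_ideal_prod[OF P \<open>finite \<Q>\<close>] t by blast
  ultimately show False
    using sub by blast
qed

text \<open>In an irredundant cover, each \<open>Q\<close> has an \<open>x Q\<close> in
  \<open>I\<close> that lies in no other member. Adding to one \<open>x Q\<close> the product of all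
  the others gives an element of \<open>I\<close> outside every member; subtractivity stands in for
  subtraction here.\<close>

lemma subtractive_prime_avoidance:
  assumes I: "semiring_ideal I" and "finite \<P>"
    and "\<And>P. P \<in> \<P> \<Longrightarrow> semiring_prime_ideal P"
    and "\<And>P a b. P \<in> \<P> \<Longrightarrow> a \<in> P \<Longrightarrow> a + b \<in> P \<Longrightarrow> b \<in> P"
    and "I \<subseteq> \<Union>\<P>"
  shows "\<exists>P\<in>\<P>. I \<subseteq> P"
  using assms(2-)
proof (induction \<P> rule: finite_psubset_induct)
  case (psubset \<P>)
  note prime = psubset.prems(1) and subtractive = psubset.prems(2)
  have ideal: "semiring_ideal P" if "P \<in> \<P>" for P
    using prime[OF that] by (simp add: semiring_prime_ideal_def)
  show ?case
  \<comment> \<open>A redundant member is dropped by induction, which leaves the irredundant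
    case.\<close>
  proof (cases "\<exists>Q\<in>\<P>. I \<subseteq> \<Union>(\<P> - {Q})")
    case True
    then obtain Q where Q: "Q \<in> \<P>" "I \<subseteq> \<Union>(\<P> - {Q})" by blast
    have "\<exists>P\<in>\<P> - {Q}. I \<subseteq> P"
    proof (rule psubset.IH)
      show "\<P> - {Q} \<subset> \<P>" "I \<subseteq> \<Union>(\<P> - {Q})" using Q by auto
      show "semiring_prime_ideal P" if "P \<in> \<P> - {Q}" for P
        using that prime by simp
      show "b \<in> P" if "P \<in> \<P> - {Q}" "a \<in> P" "a + b \<in> P" for P a b
        using that(1) subtractive[OF _ that(2,3)] by simp
    qed
    then show ?thesis by blast
  next
    case False
    then have "\<forall>Q\<in>\<P>. \<exists>x. x \<in> I \<and> x \<notin> \<Union>(\<P> - {Q})" by blast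
    then obtain x where x: "\<And>Q. Q \<in> \<P> \<Longrightarrow> x Q \<in> I \<and> x Q \<notin> \<Union>(\<P> - {Q})" by metis
    have x_in: "x Q \<in> Q" if "Q \<in> \<P>" for Q
      using x[OF that] psubset.prems(3) by blast
    \<comment> \<open>The element 0 of \<open>I\<close> must be covered, so the family is
      nonempty.\<close>
    obtain Q where Q: "Q \<in> \<P>"
      using psubset.prems(3) semiring_ideal_zero[OF I] by blast
    show ?thesis
    \<comment> \<open>For a single prime the product below would be empty, hence 1, which need not
      lie in \<open>I\<close>.\<close>
    proof (cases "\<P> = {Q}")
      case True
      then show ?thesis using psubset.prems(3) by auto
    next
      case False
      then obtain R where R: "R \<in> \<P> - {Q}" using Q by blast
      define z where "z = prod x (\<P> - {Q})"
      have fin: "finite (\<P> - {Q})" using psubset.hyps by simp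
      have "z \<in> I"
        unfolding z_def using semiring_ideal_prod[OF I fin R] x R by blast
      then have "x Q + z \<in> I"
        using semiring_ideal_add[OF I] x[OF Q] by blast
      moreover have "z \<notin> Q"
        unfolding z_def using semiring_prime_ideal_prod[OF prime[OF Q] fin, of x] x Q by blast
      then have "x Q + z \<notin> Q"
        using subtractive[OF Q x_in[OF Q]] by blast
      \<comment> \<open>The roles of the summands swap: \<open>z\<close> has the factor
        \<open>x P\<close> and lies in \<open>P\<close>, while \<open>x Q\<close> does not.\<close>
      moreover have "x Q + z \<notin> P" if P: "P \<in> \<P> - {Q}" for P
      proof -
        have "z \<in> P"
          unfolding z_def using semiring_ideal_prod[OF ideal fin P] x_in P by blast
        then show ?thesis
          using subtractive[of P z "x Q"] x[OF Q] P by (auto simp: add.commute)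
      qed
      ultimately show ?thesis using psubset.prems(3) by blast
    qed
  qed
qed

section \<open>Annihilators and Property (A)\<close>

lemma semiring_ideal_annihilator: "semiring_ideal (annihilator s)"
  by (auto simp: semiring_ideal_def annihilator_def distrib_right mult.assoc intro: exI[of _ 0])

lemma annihilator_subtractive:
  "a \<in> annihilator s \<Longrightarrow> a + b \<in> annihilator s \<Longrightarrow> b \<in> annihilator s"
  by (simp add: annihilator_def distrib_right)

lemma annihilator_commute: "a \<in> annihilator b \<longleftrightarrow> b \<in> annihilator a"
  by (simp add: annihilator_def mult.commute)

text \<open>Avoidance puts \<open>c f\<close> inside one prime \<open>annihilator s\<close>, and
  this \<open>s\<close> is the required element. What enters about \<open>c\<close> is that its
  values are ideals.\<close>

lemma very_few_zero_divisors_property_A: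
  assumes few: "very_few_zero_divisors TYPE('a::comm_semiring_1)"
    and ideal: "\<And>f. semiring_ideal (c f)"
  shows "property_A (c :: 'b \<Rightarrow> 'a set)"
  unfolding property_A_def
proof (intro allI impI)
  fix f assume sub: "c f \<subseteq> zero_divisors"
  obtain \<P> where \<P>: "finite \<P>" "\<P> \<subseteq> associated_primes" "(zero_divisors :: 'a set) = \<Union>\<P>"
    using few unfolding very_few_zero_divisors_def by blast
  have "\<exists>P\<in>\<P>. c f \<subseteq> P"
  proof (rule subtractive_prime_avoidance[OF ideal \<P>(1)])
    show "semiring_prime_ideal P" if "P \<in> \<P>" for P
      using that \<P>(2) by (auto simp: associated_primes_def)
    show "b \<in> P" if P: "P \<in> \<P>" and ab: "a \<in> P" "a + b \<in> P" for P a b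
    proof -
      obtain s where "P = annihilator s"
        using P \<P>(2) unfolding associated_primes_def by blast
      then show ?thesis using annihilator_subtractive ab by blast
    qed
    show "c f \<subseteq> \<Union>\<P>" using sub \<P>(3) by simp
  qed
  then obtain s where s: "semiring_prime_ideal (annihilator s)" "c f \<subseteq> annihilator s"
    using \<P>(2) unfolding associated_primes_def by blast
  \<comment> \<open>The annihilator of 0 is the whole semiring, but a prime is proper.\<close>
  have "s \<noteq> 0"
    using s(1) by (auto simp: semiring_prime_ideal_def annihilator_def)
  moreover have "s * t = 0" if "t \<in> c f" for t
    using that s(2) by (auto simp: annihilator_def mult.commute)
  \<comment> \<open>Equality, and not just inclusion, needs \<open>c f\<close> to be nonempty; it
    contains 0.\<close>
  then have "(\<lambda>t. s * t) ` c f = {0}"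
    using semiring_ideal_zero[OF ideal, of f] by force
  ultimately show "\<exists>s. s \<noteq> 0 \<and> (\<lambda>t. s * t) ` c f = {0}" by blast
qed

section \<open>Finite generation\<close>

lemma ideal_generated_superset: "A \<subseteq> ideal_generated A"
  by (auto simp: ideal_generated_def)

lemma ideal_generated_least: "semiring_ideal I \<Longrightarrow> A \<subseteq> I \<Longrightarrow> ideal_generated A \<subseteq> I"
  by (auto simp: ideal_generated_def)

lemma ideal_generated_mono: "A \<subseteq> B \<Longrightarrow> ideal_generated A \<subseteq> ideal_generated B"
  by (auto simp: ideal_generated_def)

text \<open>The elements with finite support form an ideal containing \<open>B\<close>, hence
  contain the smallest such ideal.\<close>

lemma ideal_generated_finite_support:
  assumes "x \<in> ideal_generated B"
  shows "\<exists>F. finite F \<and> F \<subseteq> B \<and> x \<in> ideal_generated F"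
proof -
  let ?J = "{x. \<exists>F. finite F \<and> F \<subseteq> B \<and> x \<in> ideal_generated F}"
  have "semiring_ideal ?J"
    unfolding semiring_ideal_def
  proof (intro conjI ballI allI)
    have "0 \<in> ?J"
      using semiring_ideal_zero[OF semiring_ideal_ideal_generated] by blast
    then show "?J \<noteq> {}" by blast
  next
    fix a b assume "a \<in> ?J" "b \<in> ?J"
    then obtain F G where FG: "finite F" "F \<subseteq> B" "a \<in> ideal_generated F"
      "finite G" "G \<subseteq> B" "b \<in> ideal_generated G" by blast
    have "a + b \<in> ideal_generated (F \<union> G)"
      using FG(3,6) ideal_generated_mono[of F "F \<union> G"] ideal_generated_mono[of G "F \<union> G"]
      by (intro semiring_ideal_add[OF semiring_ideal_ideal_generated]) auto
    then show "a + b \<in> ?J"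
      using FG by (intro CollectI exI[of _ "F \<union> G"]) simp
  next
    fix s a assume "a \<in> ?J"
    then show "s * a \<in> ?J"
      using semiring_ideal_mult[OF semiring_ideal_ideal_generated] by blast
  qed
  moreover have "B \<subseteq> ?J"
  proof
    fix b assume "b \<in> B"
    then show "b \<in> ?J"
      using ideal_generated_superset[of "{b}"] by (intro CollectI exI[of _ "{b}"]) simp
  qed
  ultimately show ?thesis
    using ideal_generated_least assms by blast
qed

text \<open>The finite generators supplied by the hypothesis may lie outside \<open>B\<close>; each
  is replaced by a finite part of \<open>B\<close> that generates it.\<close>

lemma noetherian_finite_generating_subset:
  assumes "noetherian_semiring TYPE('a::comm_semiring_1)"
  shows "\<exists>F. finite F \<and> F \<subseteq> B \<and> (B :: 'a set) \<subseteq> ideal_generated F"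
proof -
  obtain A where A: "finite A" "ideal_generated B = ideal_generated A"
    using assms semiring_ideal_ideal_generated unfolding noetherian_semiring_def by blast
  have "A \<subseteq> ideal_generated B"
    using A(2) ideal_generated_superset[of A] by simp
  then have "\<forall>a\<in>A. \<exists>F. finite F \<and> F \<subseteq> B \<and> a \<in> ideal_generated F"
    using ideal_generated_finite_support[of _ B] by (meson subsetD)
  then obtain F where F: "\<And>a. a \<in> A \<Longrightarrow> finite (F a) \<and> F a \<subseteq> B \<and> a \<in> ideal_generated (F a)"
    by metis
  have "A \<subseteq> ideal_generated (\<Union>a\<in>A. F a)"
  proof
    fix a assume "a \<in> A"
    then show "a \<in> ideal_generated (\<Union>a\<in>A. F a)"
      using F ideal_generated_mono[of "F a" "\<Union>a\<in>A. F a"] by blast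
  qed
  then have "B \<subseteq> ideal_generated (\<Union>a\<in>A. F a)"
    using A(2) ideal_generated_superset[of B]
      ideal_generated_least[OF semiring_ideal_ideal_generated] by blast
  moreover have "finite (\<Union>a\<in>A. F a)" "(\<Union>a\<in>A. F a) \<subseteq> B"
    using A(1) F by auto
  ultimately show ?thesis by blast
qed

section \<open>Maximal annihilators and the Noetherian case\<close>

definition maximal_annihilator :: "'a::comm_semiring_1 \<Rightarrow> bool" where
  "maximal_annihilator s \<longleftrightarrow>
     s \<noteq> 0 \<and> (\<forall>t. t \<noteq> 0 \<longrightarrow> annihilator s \<subseteq> annihilator t \<longrightarrow> annihilator t = annihilator s)"

text \<open>If \<open>b * s\<close> is nonzero, its annihilator contains that of \<open>s\<close>,
  so maximality makes them equal; and \<open>a\<close> kills \<open>b * s\<close>.\<close>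

lemma maximal_annihilator_prime:
  assumes "maximal_annihilator s"
  shows "semiring_prime_ideal (annihilator s)"
  unfolding semiring_prime_ideal_def
proof (intro conjI allI impI semiring_ideal_annihilator)
  have "1 \<notin> annihilator s"
    using assms by (simp add: maximal_annihilator_def annihilator_def)
  then show "annihilator s \<noteq> UNIV" by blast
next
  fix a b assume ab: "a * b \<in> annihilator s"
  show "a \<in> annihilator s \<or> b \<in> annihilator s"
  proof (cases "b * s = 0")
    case True
    then show ?thesis by (simp add: annihilator_def)
  next
    case False
    have "annihilator s \<subseteq> annihilator (b * s)"
      by (auto simp: annihilator_def mult.left_commute[of _ b])
    then have "annihilator (b * s) = annihilator s"
      using assms False by (simp add: maximal_annihilator_def)
    moreover have "a \<in> annihilator (b * s)"
      using ab by (simp add: annihilator_def mult.assoc)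
    ultimately show ?thesis by simp
  qed
qed

text \<open>Zorn's lemma applies because the union of a nonempty chain is attained: finitely many
  elements generating it already lie in one member.\<close>

lemma noetherian_maximal_annihilator_exists:
  fixes t :: "'a::comm_semiring_1"
  assumes noeth: "noetherian_semiring TYPE('a)" and "t \<noteq> 0"
  shows "\<exists>s. maximal_annihilator s \<and> annihilator t \<subseteq> annihilator s"
proof -
  let ?A = "{annihilator s | s. s \<noteq> 0 \<and> annihilator t \<subseteq> annihilator s}"
  have "\<exists>M\<in>?A. \<forall>X\<in>?A. M \<subseteq> X \<longrightarrow> X = M"
  proof (rule subset_Zorn_nonempty)
    show "?A \<noteq> {}" using \<open>t \<noteq> 0\<close> by blast
  next
    fix C assume "C \<noteq> {}" and chain: "subset.chain ?A C"
    obtain F where F: "finite F" "F \<subseteq> \<Union>C" "\<Union>C \<subseteq> ideal_generated F"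
      using noetherian_finite_generating_subset[OF noeth] by blast
    obtain X where X: "X \<in> C" "F \<subseteq> X"
      using finite_subset_Union_chain[OF F(1,2) \<open>C \<noteq> {}\<close> chain] by blast
    have XA: "X \<in> ?A"
      using X(1) chain by (auto simp: subset.chain_def)
    then have "semiring_ideal X"
      using semiring_ideal_annihilator by blast
    then have "\<Union>C = X"
      using F(3) X ideal_generated_least[of X F] by blast
    then show "\<Union>C \<in> ?A" using XA by simp
  qed
  then obtain M where "M \<in> ?A" and max: "\<forall>X\<in>?A. M \<subseteq> X \<longrightarrow> X = M" by (rule bexE)
  then obtain s where s: "s \<noteq> 0" "annihilator t \<subseteq> annihilator s" "M = annihilator s" by auto
  have "annihilator u = annihilator s" if "u \<noteq> 0" "annihilator s \<subseteq> annihilator u" for u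
  proof -
    have "annihilator u \<in> ?A" using that s(2) by auto
    then show ?thesis using max that(2) s(3) by simp
  qed
  then have "maximal_annihilator s"
    using s(1) by (simp add: maximal_annihilator_def)
  then show ?thesis using s(2) by blast
qed

lemma noetherian_very_few_zero_divisors:
  assumes noeth: "noetherian_semiring TYPE('a::comm_semiring_1)"
  shows "very_few_zero_divisors TYPE('a)"
proof -
  let ?B = "{s :: 'a. maximal_annihilator s}"
  obtain F where F: "finite F" "F \<subseteq> ?B" "?B \<subseteq> ideal_generated F"
    using noetherian_finite_generating_subset[OF noeth] by blast
  have in_F: "annihilator s \<in> annihilator ` F" if s: "maximal_annihilator s" for s
  proof -
    have "t \<in> annihilator s" if "t \<in> \<Inter>(annihilator ` F)" for t
    proof -
      \<comment> \<open>Annihilation is symmetric: \<open>t\<close> kills all of \<open>F\<close>,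
        so the ideal \<open>annihilator t\<close> contains whatever \<open>F\<close> generates, in
        particular \<open>s\<close>.\<close>
      have "F \<subseteq> annihilator t"
        using that annihilator_commute by blast
      then have "s \<in> annihilator t"
        using ideal_generated_least[OF semiring_ideal_annihilator] F(3) s by blast
      then show ?thesis using annihilator_commute by blast
    qed
    then have "\<exists>Q\<in>annihilator ` F. Q \<subseteq> annihilator s"
      using F(1) semiring_ideal_annihilator
      by (intro semiring_prime_ideal_Inter_subset maximal_annihilator_prime[OF s]) auto
    then obtain u where u: "u \<in> F" "annihilator u \<subseteq> annihilator s" by blast
    \<comment> \<open>The maximality used is that of \<open>u\<close>, an element of
      \<open>F\<close>, together with \<open>s\<close> being nonzero.\<close>
    have "annihilator s = annihilator u"
      using F(2) u s by (auto simp: maximal_annihilator_def)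
    then show ?thesis using u(1) by blast
  qed
  have "(zero_divisors :: 'a set) = \<Union>(annihilator ` F)"
  proof
    show "zero_divisors \<subseteq> \<Union>(annihilator ` F)"
    proof
      fix z :: 'a assume "z \<in> zero_divisors"
      then obtain t where t: "t \<noteq> 0" "z \<in> annihilator t"
        by (auto simp: zero_divisors_def annihilator_def)
      then show "z \<in> \<Union>(annihilator ` F)"
        using noetherian_maximal_annihilator_exists[OF noeth t(1)] in_F by blast
    qed
    show "\<Union>(annihilator ` F) \<subseteq> zero_divisors"
      using F(2) by (auto simp: zero_divisors_def annihilator_def maximal_annihilator_def)
  qed
  moreover have "annihilator ` F \<subseteq> associated_primes"
    using F(2) maximal_annihilator_prime by (auto simp: associated_primes_def)
  ultimately show ?thesis
    using F(1) unfolding very_few_zero_divisors_def by blast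
qed

theorem corollary3p7:
  shows "(very_few_zero_divisors TYPE('a::comm_semiring_1)
            \<longrightarrow> property_A (content_ideal :: 'a poly \<Rightarrow> 'a set))
       \<and> (noetherian_semiring TYPE('a)
            \<longrightarrow> very_few_zero_divisors TYPE('a))"
  using very_few_zero_divisors_property_A[OF _ semiring_ideal_content_ideal]
    noetherian_very_few_zero_divisors by (intro conjI impI)

end
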